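(* If $n=m^2$ with $m$ an odd integer, then there is a digraph $G$ of order $n$ such that $$\zeta(G)=\frac{n}{2}-\sqrt{n}+\frac{3}{2}=(1-o(1))\frac{n}{2},$$ where the asymptotics are as $n\to\infty$.
   Context: All digraphs are finite, nonempty, simple and oriented (no loops, at most one arc between any two distinct vertices), and need not be strongly connected. $d(u,v)$ is the length of a shortest directed path from $u$ to $v$, and $d(u,v)=\infty$ if there is no such path. The Localization game with $k$ cops on $G$: an invisible robber first chooses a vertex; in each round the cops choose vertices $u_1,\dots,u_k$ (any vertices, chosen afresh each round) and learn the distance vector $(d(u_1,x),\ldots,d(u_k,x))$, where $x$ is the robber's current vertex; then the robber stays at $x$ or moves along an arc $(x,y)$ to an out-neighbor $y$. The cops win if they have a strategy which, whatever the robber does, after finitely many rounds determines a unique possible vertex for the robber right after a probe (using all information received so far); otherwise the robber wins. The localization number $\zeta(G)$ is the least positive integer $k$ for which $k$ cops have a winning strategy. *)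

theory Defs
  imports Complex_Main "HOL-Library.Landau_Symbols" "Graph_Theory.Graph_Theory"
begin

locale oriented_digraph = digraph G for G (structure) +
  assumes verts_nonempty: "verts G \<noteq> {}"
    and oriented: "\<And>u v. u \<rightarrow>\<^bsub>G\<^esub> v \<Longrightarrow> \<not> v \<rightarrow>\<^bsub>G\<^esub> u"
begin

(* The library's shortest-path cost for unit weights; it is \<infinity> if v is not reachable from u. *)
definition digraph_dist :: "'a \<Rightarrow> 'a \<Rightarrow> ereal" where
  "digraph_dist u v = \<mu> (\<lambda>_. 1) u v"

definition probe :: "'a list \<Rightarrow> 'a \<Rightarrow> ereal list" where
  "probe us x = map (\<lambda>u. digraph_dist u x) us"

(* x t is the vertex of the robber at the time of probe number t (counted from 0). *)
definition robber_play :: "(nat \<Rightarrow> 'a) \<Rightarrow> bool" where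
  "robber_play x \<longleftrightarrow> x 0 \<in> verts G \<and> (\<forall>t. x (Suc t) = x t \<or> x t \<rightarrow>\<^bsub>G\<^esub> x (Suc t))"

(* A strategy maps the list of distance vectors received so far to the next k probed vertices.
   The earlier probes need not be arguments: they are determined by the strategy itself and the
   earlier answers. *)
definition cop_strategy :: "nat \<Rightarrow> (ereal list list \<Rightarrow> 'a list) \<Rightarrow> bool" where
  "cop_strategy k \<sigma> \<longleftrightarrow> (\<forall>h. length (\<sigma> h) = k \<and> set (\<sigma> h) \<subseteq> verts G)"

primrec answers :: "(ereal list list \<Rightarrow> 'a list) \<Rightarrow> (nat \<Rightarrow> 'a) \<Rightarrow> nat \<Rightarrow> ereal list list" where
  "answers \<sigma> x 0 = []"
| "answers \<sigma> x (Suc t) = answers \<sigma> x t @ [probe (\<sigma> (answers \<sigma> x t)) (x t)]"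

(* The vertices where the robber can be right after probe number t, given all answers up to and
   including that probe. *)
definition possible_vertices ::
    "(ereal list list \<Rightarrow> 'a list) \<Rightarrow> (nat \<Rightarrow> 'a) \<Rightarrow> nat \<Rightarrow> 'a set" where
  "possible_vertices \<sigma> x t =
     {y t | y. robber_play y \<and> answers \<sigma> y (Suc t) = answers \<sigma> x (Suc t)}"

definition cops_win :: "nat \<Rightarrow> bool" where
  "cops_win k \<longleftrightarrow>
     (\<exists>\<sigma>. cop_strategy k \<sigma> \<and> (\<forall>x. robber_play x \<longrightarrow> (\<exists>t. \<exists>v. possible_vertices \<sigma> x t = {v})))"

definition localization_number :: nat where
  "localization_number = (LEAST k. 0 < k \<and> cops_win k)"

end

end

theory Submission
  imports Defs
begin

text \<open>
  Write $m = 2r+1$. The digraph that attains the value is a blow-up of the rotational tournament on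
  $\mathbb{Z}_m$, in which $i$ beats $i+1, \dots, i+r$: every vertex of the tournament is replaced
  by a group of $m$ independent vertices. It has $m^2$ vertices, and its distances have just four
  values: 0 from a vertex to itself, 1 along an arc, 2 against an arc, and 3 between two distinct
  vertices of a group (lemma \<open>digraph_dist_blowup\<close>). The vertices of one group are twins: a cop
  separates two of them only by probing one of the two. On the other hand any cop in a group tells
  whether the robber is in that group.

  The value is $2r^2+1 = n/2 - \sqrt n + 3/2$. From a pair of twins the robber can either
  stay or escape into one of $r$ out-groups. To deny him an unseen pair of twins in every out-group
  the cops have to spend $m-1 = 2r$ probes on each of them, and then one more on the pair itself.
  With $2r^2$ probes they fail in one of the two tasks, so that two robbers who are never
  distinguished can go on for ever (lemmas \<open>robber_evades\<close> and \<open>not_cops_win_blowup\<close>).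

  One more probe suffices (lemma \<open>cops_win_blowup\<close>). Since $2r^2+1 \geq m$, the first round can
  probe every group and so finds the group of the robber. From then on the cops probe $2r$ vertices
  of each of its $r$ out-groups, so a robber who leaves is identified on arrival, and they use the
  last probe to walk through the group itself. A robber who never leaves the group never moves, as
  there are no arcs inside it, and is hit after at most $m$ rounds.
\<close>

section \<open>General facts on the game\<close>

context oriented_digraph
begin

lemma digraph_dist_eqI:
  assumes "awalk u p v" and "\<And>q. awalk u q v \<Longrightarrow> length p \<le> length q"
  shows "digraph_dist u v = ereal (length p)"
proof -
  have cost: "awalk_cost (\<lambda>_. 1) q = length q" for q
    by (induct q) auto
  show ?thesis
    unfolding digraph_dist_def \<mu>_def cost
    by (rule antisym) (use assms in \<open>auto intro!: INF_lower2 INF_greatest\<close>)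
qed

lemma length_answers [simp]: "length (answers \<sigma> x t) = t"
  by (induct t) auto

lemma hd_answers_Suc:
  "hd (answers \<sigma> x (Suc t)) = probe (\<sigma> []) (x 0)"
proof (induct t)
  case (Suc t)
  have "answers \<sigma> x (Suc t) \<noteq> []" by simp
  then show ?case using Suc by (simp only: answers.simps(2)[of \<sigma> x "Suc t"] hd_append if_False)
qed simp

lemma robber_play_in_verts: "robber_play x \<Longrightarrow> x t \<in> verts G"
proof (induct t)
  case (Suc t)
  then have "x (Suc t) = x t \<or> x t \<rightarrow> x (Suc t)" by (simp add: robber_play_def)
  with Suc show ?case using adj_in_verts(2) by metis
qed (simp add: robber_play_def)

text \<open>
  The second play is compared with the first on the probes made against the first. This is sound
  because equal answers so far make the strategy choose equal probes.
\<close>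

lemma answers_eqD:
  assumes "answers \<sigma> y (Suc t) = answers \<sigma> x (Suc t)" and "s \<le> t"
    and "u \<in> set (\<sigma> (answers \<sigma> x s))"
  shows "digraph_dist u (y s) = digraph_dist u (x s)"
proof -
  have "answers \<sigma> y (Suc s) = answers \<sigma> x (Suc s)"
    using assms(2,1) by (induct rule: inc_induct) auto
  then have "answers \<sigma> y s = answers \<sigma> x s \<and>
      probe (\<sigma> (answers \<sigma> y s)) (y s) = probe (\<sigma> (answers \<sigma> x s)) (x s)"
    unfolding answers.simps(2) append1_eq_conv .
  then have "probe (\<sigma> (answers \<sigma> x s)) (y s) = probe (\<sigma> (answers \<sigma> x s)) (x s)"
    by metis
  with assms(3) show ?thesis unfolding probe_def by auto
qed

text \<open>
  The robber escapes if he has a relation of \<open>undistinguished pairs\<close> that he can keep up: whatever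
  is probed, both partners have a move that leads to such a pair with equal answers. Since each
  partner moves on its own, the first components and the second components of the pairs are two
  complete plays with the same answers that never meet.
\<close>

lemma robber_evades:
  assumes start: "W a0 b0"
    and pair: "\<And>a b. W a b \<Longrightarrow> a \<noteq> b \<and> a \<in> verts G \<and> b \<in> verts G"
    and step: "\<And>a b us. \<lbrakk>W a b; length us = k; set us \<subseteq> verts G\<rbrakk> \<Longrightarrow>
      \<exists>a' b'. W a' b' \<and> (a' = a \<or> a \<rightarrow> a') \<and> (b' = b \<or> b \<rightarrow> b') \<and> probe us a' = probe us b'"
  shows "\<not> cops_win k"
proof
  assume "cops_win k"
  then obtain \<sigma> where \<sigma>: "cop_strategy k \<sigma>"
    and win: "\<And>x. robber_play x \<Longrightarrow> \<exists>t v. possible_vertices \<sigma> x t = {v}"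
    unfolding cops_win_def by blast
  have len: "length (\<sigma> h) = k" "set (\<sigma> h) \<subseteq> verts G" for h
    using \<sigma> by (auto simp: cop_strategy_def)
  (* The strategy is fixed, so a state that carries the common history determines the next probes. *)
  let ?ok = "\<lambda>(h, a, b). W a b \<and> probe (\<sigma> h) a = probe (\<sigma> h) b"
  let ?next = "\<lambda>(h, a, b) (h', a', b'). h' = h @ [probe (\<sigma> h) a] \<and>
      (a' = a \<or> a \<rightarrow> a') \<and> (b' = b \<or> b \<rightarrow> b')"
  have "\<exists>s. \<forall>t. (?ok (s t) \<and> (t = 0 \<longrightarrow> fst (s t) = [])) \<and> ?next (s t) (s (Suc t))"
  proof (rule dependent_nat_choice)
    show "\<exists>s. ?ok s \<and> (0 = (0::nat) \<longrightarrow> fst s = [])"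
      using step[OF start len(1)[of "[]"] len(2)[of "[]"]] by fastforce
  next
    fix s :: "ereal list list \<times> 'a \<times> 'a" and t :: nat
    assume s: "?ok s \<and> (t = 0 \<longrightarrow> fst s = [])"
    obtain h a b where [simp]: "s = (h, a, b)" by (cases s)
    let ?h = "h @ [probe (\<sigma> h) a]"
    have "W a b" using s by simp
    from step[OF this len(1)[of ?h] len(2)[of ?h]]
    obtain a' b' where "W a' b'" "a' = a \<or> a \<rightarrow> a'" "b' = b \<or> b \<rightarrow> b'"
      "probe (\<sigma> ?h) a' = probe (\<sigma> ?h) b'" by blast
    then show "\<exists>s'. (?ok s' \<and> (Suc t = 0 \<longrightarrow> fst s' = [])) \<and> ?next s s'"
      by (intro exI[of _ "(?h, a', b')"]) simp
  qed
  then obtain s where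
    "\<forall>t. (?ok (s t) \<and> (t = 0 \<longrightarrow> fst (s t) = [])) \<and> ?next (s t) (s (Suc t))" ..
  then have s: "\<And>t. ?ok (s t)" "fst (s 0) = []" "\<And>t. ?next (s t) (s (Suc t))"
    by simp_all
  define h a b where "h t = fst (s t)" and "a t = fst (snd (s t))" and "b t = snd (snd (s t))" for t
  have st: "s t = (h t, a t, b t)" for t
    by (simp add: h_def a_def b_def)
  have W: "W (a t) (b t)" and same: "probe (\<sigma> (h t)) (a t) = probe (\<sigma> (h t)) (b t)" for t
    using s(1)[of t] by (auto simp: st)
  have h: "h 0 = []" "h (Suc t) = h t @ [probe (\<sigma> (h t)) (a t)]" for t
    using s(2) s(3)[of t] by (auto simp: st)
  have plays: "robber_play a" "robber_play b"
    using W pair s(3) by (auto simp: robber_play_def st)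
  have ans: "answers \<sigma> a t = h t" "answers \<sigma> b t = h t" for t
    by (induct t) (auto simp: h same)
  from win[OF plays(1)] obtain t v where v: "possible_vertices \<sigma> a t = {v}" by blast
  have "answers \<sigma> b (Suc t) = answers \<sigma> a (Suc t)" by (simp only: ans)
  then have "a t \<in> possible_vertices \<sigma> a t" "b t \<in> possible_vertices \<sigma> a t"
    using plays unfolding possible_vertices_def by blast+
  with v pair[OF W[of t]] show False by auto
qed

end

section \<open>The blown-up rotational tournament\<close>

text \<open>
  The vertex \<open>v\<close> belongs to the group \<open>v mod (2 * r + 1)\<close>, and the offset is the step
  between the groups of two vertices. Taking it in the integers modulo \<open>2 * r + 1\<close> spares a
  reduction of the two vertices to their groups.
\<close>

definition offset :: "nat \<Rightarrow> nat \<Rightarrow> nat \<Rightarrow> int" where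
  "offset r u v = (int v - int u) mod (2 * int r + 1)"

definition blowup :: "nat \<Rightarrow> (nat, nat \<times> nat) pre_digraph" where
  "blowup r = \<lparr>verts = {..<(2 * r + 1)\<^sup>2},
     arcs = {(u, v). u < (2 * r + 1)\<^sup>2 \<and> v < (2 * r + 1)\<^sup>2 \<and> offset r u v \<in> {1..int r}},
     tail = fst, head = snd\<rparr>"

lemma blowup_simps [simp]:
  "verts (blowup r) = {..<(2 * r + 1)\<^sup>2}" "tail (blowup r) = fst" "head (blowup r) = snd"
  by (simp_all add: blowup_def)

lemma arcs_blowup:
  "(u, v) \<in> arcs (blowup r) \<longleftrightarrow>
    u < (2 * r + 1)\<^sup>2 \<and> v < (2 * r + 1)\<^sup>2 \<and> offset r u v \<in> {1..int r}"
  by (simp add: blowup_def)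

lemma dominates_blowup:
  "u \<rightarrow>\<^bsub>blowup r\<^esub> v \<longleftrightarrow>
    u < (2 * r + 1)\<^sup>2 \<and> v < (2 * r + 1)\<^sup>2 \<and> offset r u v \<in> {1..int r}"
  unfolding arcs_blowup[symmetric] by (force simp: arcs_ends_conv)

lemma offset_bounds: "0 \<le> offset r u v" "offset r u v \<le> 2 * int r"
  by (auto simp: offset_def) (use pos_mod_bound[of "2 * int r + 1" "int v - int u"] in linarith)

lemma offset_add: "offset r u v = (offset r u w + offset r w v) mod (2 * int r + 1)"
  by (simp add: offset_def mod_add_eq)

lemma offset_self [simp]: "offset r u u = 0"
  by (simp add: offset_def)

text \<open>
  For a nonzero offset this is \<open>2 * r + 1\<close> minus it, so exactly one of the two directions has an
  offset of at most \<open>r\<close>: between different groups all arcs exist in exactly one direction.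
\<close>

lemma offset_flip: "offset r v u = (- offset r u v) mod (2 * int r + 1)"
  by (simp add: offset_def mod_minus_eq)

lemma offset_eq_0_iff: "offset r u v = 0 \<longleftrightarrow> u mod (2 * r + 1) = v mod (2 * r + 1)"
proof -
  have "offset r u v = 0 \<longleftrightarrow> int v mod (2 * int r + 1) = int u mod (2 * int r + 1)"
    unfolding offset_def by (metis mod_eq_dvd_iff dvd_eq_mod_eq_0)
  also have "\<dots> \<longleftrightarrow> int (v mod (2 * r + 1)) = int (u mod (2 * r + 1))"
    by (simp add: zmod_int add.commute)
  finally show ?thesis by auto
qed

lemma offset_cong_left: "offset r u w = 0 \<Longrightarrow> offset r u v = offset r w v"
  using offset_add[of r u v w] offset_bounds[of r w v] by simp

lemma offset_cong_right: "offset r v w = 0 \<Longrightarrow> offset r u v = offset r u w"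
  using offset_add[of r u w v] offset_bounds[of r u v] by simp

lemma offset_shift:
  assumes "d < 2 * r + 1"
  shows "offset r u ((u + d) mod (2 * r + 1)) = int d"
proof -
  have "offset r u ((u + d) mod (2 * r + 1)) = offset r u (u + d)"
    by (rule offset_cong_right) (simp add: offset_eq_0_iff)
  also have "\<dots> = int d" using assms by (simp add: offset_def)
  finally show ?thesis .
qed

lemma offset_from_shift:
  assumes "d < 2 * r + 1"
  shows "offset r ((u + d) mod (2 * r + 1)) v = (offset r u v - int d) mod (2 * int r + 1)"
proof -
  let ?w = "(u + d) mod (2 * r + 1)"
  have "offset r ?w u = (- int d) mod (2 * int r + 1)"
    using offset_flip[of r ?w u] offset_shift[OF assms, of u] by simp
  then show ?thesis
    using offset_add[of r ?w v u] by (simp add: mod_add_left_eq)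
qed

lemma offset_eq_iff:
  assumes "d < 2 * r + 1"
  shows "offset r u v = int d \<longleftrightarrow> v mod (2 * r + 1) = (u + d) mod (2 * r + 1)"
proof
  let ?w = "(u + d) mod (2 * r + 1)"
  assume "offset r u v = int d"
  then have "offset r ?w v = 0" using offset_from_shift[OF assms, of u v] by simp
  then show "v mod (2 * r + 1) = ?w" by (simp add: offset_eq_0_iff)
next
  let ?w = "(u + d) mod (2 * r + 1)"
  assume "v mod (2 * r + 1) = ?w"
  then have "offset r v ?w = 0" by (simp add: offset_eq_0_iff)
  then show "offset r u v = int d"
    using offset_cong_right[of r v ?w u] offset_shift[OF assms, of u] by simp
qed

lemma oriented_digraph_blowup: "oriented_digraph (blowup r)"
proof
  show "finite (arcs (blowup r))"
    by (rule finite_subset[of _ "{..<(2 * r + 1)\<^sup>2} \<times> {..<(2 * r + 1)\<^sup>2}"]) (auto simp: blowup_def)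
  have "0 \<in> verts (blowup r)" by simp
  then show "verts (blowup r) \<noteq> {}" by blast
next
  fix u v assume "u \<rightarrow>\<^bsub>blowup r\<^esub> v"
  then have o: "offset r u v \<in> {1..int r}" by (simp add: dominates_blowup)
  have "offset r v u = (- offset r u v + (2 * int r + 1)) mod (2 * int r + 1)"
    by (simp add: offset_flip[of r v u])
  also have "\<dots> = - offset r u v + (2 * int r + 1)"
    using o by (intro mod_pos_pos_trivial) auto
  finally show "\<not> v \<rightarrow>\<^bsub>blowup r\<^esub> u" using o by (auto simp: dominates_blowup)
qed (auto simp: blowup_def arc_to_ends_def)

interpretation blowup: oriented_digraph "blowup r" for r
  by (rule oriented_digraph_blowup)

text \<open>
  An offset of \<open>r + d\<close> with \<open>1 \<le> d \<le> r\<close> is the sum of the two arc offsets \<open>r\<close> and \<open>d\<close>, and a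
  full turn is \<open>r + r + 1\<close>. This gives the walks of length 2 and 3. No shorter ones exist: an
  arc has an offset of at most \<open>r\<close>, and the sum of two arc offsets lies strictly between 0 and
  \<open>2 * r + 1\<close>, so two arcs never make a full turn.
\<close>

lemma digraph_dist_blowup:
  assumes u: "u < (2 * r + 1)\<^sup>2" and v: "v < (2 * r + 1)\<^sup>2"
  shows "blowup.digraph_dist r u v =
    (if u = v then 0 else if offset r u v = 0 then 3 else if offset r u v \<le> int r then 1 else 2)"
proof -
  let ?m = "2 * r + 1"
  (* The representative below ?m of the group that lies d steps after the group of u. *)
  let ?w = "\<lambda>d. (u + d) mod ?m"
  have w: "?w d < ?m\<^sup>2" for d
  proof -
    have "?w d < ?m" by simp
    also have "?m \<le> ?m\<^sup>2" by (simp add: power2_eq_square)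
    finally show ?thesis .
  qed
  have ends: "blowup.awalk r u q v \<Longrightarrow> u = v \<or> length q \<ge> 1" for q
    by (cases q) (auto simp: blowup.awalk_Nil_iff)
  have one: "blowup.awalk r u q v \<Longrightarrow> u = v \<or> offset r u v \<in> {1..int r} \<or> length q \<ge> 2" for q
    by (cases q; cases "tl q") (auto simp: blowup.awalk_simps arcs_blowup)
  have two: "u = v \<or> offset r u v > 0 \<or> length q \<ge> 3" if q: "blowup.awalk r u q v" for q
  proof (rule ccontr)
    assume c: "\<not> ?thesis"
    then have "offset r u v = 0" using offset_bounds[of r u v] by auto
    with one[OF q] c have "length q = 2" by auto
    then obtain e f where "q = [e, f]" by (auto simp: numeral_2_eq_2 length_Suc_conv)
    with q have w: "offset r u (snd e) \<in> {1..int r}" "offset r (snd e) v \<in> {1..int r}"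
      by (cases e; cases f; auto simp: blowup.awalk_simps arcs_blowup)+
    then have "offset r u v = offset r u (snd e) + offset r (snd e) v"
      by (subst offset_add[where w = "snd e"]) (intro mod_pos_pos_trivial; auto)
    with w \<open>offset r u v = 0\<close> show False by auto
  qed
  consider "u = v" | "u \<noteq> v" "offset r u v = 0" | "offset r u v \<in> {1..int r}"
    | "offset r u v \<in> {int r + 1..2 * int r}"
    using offset_bounds[of r u v] by fastforce
  then show ?thesis
  proof cases
    case 1
    then show ?thesis
      using blowup.digraph_dist_eqI[of r u "[]" v] u by (simp add: blowup.awalk_simps)
  next
    case 2
    have "r \<noteq> 0"
    proof
      assume "r = 0"
      then show False using 2 u v by simp
    qed
    have "(- (2 * int r)) mod (2 * int r + 1) = (- (2 * int r) + (2 * int r + 1)) mod (2 * int r + 1)"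
      by (rule mod_add_self2[symmetric])
    also have "\<dots> = 1" using \<open>r \<noteq> 0\<close> by simp
    finally have minus: "(- (2 * int r)) mod (2 * int r + 1) = 1" .
    have last: "offset r (?w (2 * r)) v = 1"
      using offset_from_shift[of "2 * r"] 2 minus by simp
    have mid: "offset r (?w r) (?w (2 * r)) = int r"
      using offset_shift[of r r "?w r"] by (simp add: mod_simps mult_2 add.assoc)
    have "blowup.awalk r u [(u, ?w r), (?w r, ?w (2 * r)), (?w (2 * r), v)] v"
      using u v w[of r] w[of "2 * r"] last mid offset_shift[of r r u] \<open>r \<noteq> 0\<close>
      by (simp add: blowup.awalk_simps arcs_blowup)
    moreover have "length [(u, ?w r), (?w r, ?w (2 * r)), (?w (2 * r), v)] \<le> length q"
      if "blowup.awalk r u q v" for q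
      using two[OF that] 2 by simp
    ultimately have "blowup.digraph_dist r u v = ereal (length [(u, ?w r), (?w r, ?w (2 * r)), (?w (2 * r), v)])"
      by (rule blowup.digraph_dist_eqI)
    then show ?thesis using 2 by simp
  next
    case 3
    then have "blowup.awalk r u [(u, v)] v"
      using u v by (simp add: blowup.awalk_simps arcs_blowup)
    moreover have "length [(u, v)] \<le> length q" if "blowup.awalk r u q v" for q
      using ends[OF that] 3 by auto
    ultimately have "blowup.digraph_dist r u v = ereal (length [(u, v)])"
      by (rule blowup.digraph_dist_eqI)
    then show ?thesis using 3 by auto
  next
    case 4
    then have "offset r (?w r) v = offset r u v - int r"
      by (subst offset_from_shift) (auto intro!: mod_pos_pos_trivial)
    then have "blowup.awalk r u [(u, ?w r), (?w r, v)] v"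
      using u v w[of r] offset_shift[of r r u] 4
      by (simp add: blowup.awalk_simps arcs_blowup)
    moreover have "length [(u, ?w r), (?w r, v)] \<le> length q" if "blowup.awalk r u q v" for q
      using one[OF that] 4 by auto
    ultimately have "blowup.digraph_dist r u v = ereal (length [(u, ?w r), (?w r, v)])"
      by (rule blowup.digraph_dist_eqI)
    then show ?thesis using 4 by auto
  qed
qed

text \<open>
  The cops use the distances only through the next two lemmas: a probe recognizes its own vertex and
  its own group.
\<close>

lemma dist_blowup_eq_0_iff:
  assumes "u < (2 * r + 1)\<^sup>2" "v < (2 * r + 1)\<^sup>2"
  shows "blowup.digraph_dist r u v = 0 \<longleftrightarrow> u = v"
  using digraph_dist_blowup[OF assms] by simp

lemma dist_blowup_same_group_iff:
  assumes "u < (2 * r + 1)\<^sup>2" "v < (2 * r + 1)\<^sup>2"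
  shows "blowup.digraph_dist r u v \<in> {0, 3} \<longleftrightarrow> u mod (2 * r + 1) = v mod (2 * r + 1)"
proof -
  have "1 \<noteq> (3 :: ereal)" "2 \<noteq> (3 :: ereal)" by (simp_all add: one_ereal_def)
  then show ?thesis
    unfolding offset_eq_0_iff[symmetric] using digraph_dist_blowup[OF assms] by auto
qed

lemma dist_blowup_twin:
  assumes "a < (2 * r + 1)\<^sup>2" "b < (2 * r + 1)\<^sup>2" "u < (2 * r + 1)\<^sup>2"
    and "offset r a b = 0" "u \<noteq> a" "u \<noteq> b"
  shows "blowup.digraph_dist r u a = blowup.digraph_dist r u b"
  using assms offset_cong_right[of r a b u] by (simp add: digraph_dist_blowup)

lemma vertex_lt:
  fixes i c m :: nat
  assumes "i < m" "c < m"
  shows "i + m * c < m\<^sup>2"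
proof -
  have "i + m * c < m * Suc c" using assms(1) by simp
  also have "\<dots> \<le> m\<^sup>2" unfolding power2_eq_square using assms(2) by (intro mult_le_mono2) simp
  finally show ?thesis .
qed

lemma card_group:
  assumes "d < 2 * r + 1"
  shows "card {v. v < (2 * r + 1)\<^sup>2 \<and> offset r a v = int d} = 2 * r + 1"
proof -
  let ?m = "2 * r + 1" and ?i = "(a + d) mod (2 * r + 1)"
  have "{v. v < ?m\<^sup>2 \<and> v mod ?m = ?i} = (\<lambda>c. ?i + ?m * c) ` {..<?m}"
  proof (intro equalityI subsetI)
    fix v assume "v \<in> {v. v < ?m\<^sup>2 \<and> v mod ?m = ?i}"
    then have v: "v < ?m * ?m" "v mod ?m = ?i" by (auto simp: power2_eq_square)
    have "v = ?i + ?m * (v div ?m)" using mod_mult_div_eq[of v ?m] v(2) by linarith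
    moreover have "v div ?m < ?m" using v(1) by (rule less_mult_imp_div_less)
    ultimately show "v \<in> (\<lambda>c. ?i + ?m * c) ` {..<?m}" by blast
  next
    fix v assume "v \<in> (\<lambda>c. ?i + ?m * c) ` {..<?m}"
    then obtain c where c: "c < ?m" "v = ?i + ?m * c" by blast
    have "v mod ?m = ?i mod ?m" unfolding c(2) by (rule mod_mult_self2)
    moreover have "v < ?m\<^sup>2" unfolding c(2) using c(1) by (intro vertex_lt) simp_all
    ultimately show "v \<in> {v. v < ?m\<^sup>2 \<and> v mod ?m = ?i}" by simp
  qed
  moreover have "inj_on (\<lambda>c. ?i + ?m * c) {..<?m}"
  proof (rule inj_onI)
    fix x y assume "?i + ?m * x = ?i + ?m * y"
    then have "?m * x = ?m * y" by (rule add_left_imp_eq)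
    then show "x = y" using nat_mult_eq_cancel1[of ?m x y] by linarith
  qed
  ultimately show ?thesis
    unfolding offset_eq_iff[OF assms] by (simp add: card_image)
qed

section \<open>Too few cops\<close>

text \<open>
  The undistinguished pairs are pairs of twins. If some out-group contains two vertices that are not
  probed, these are the next pair. Otherwise at least \<open>2 * r\<close> vertices of each of the \<open>r\<close>
  out-groups are probed; this uses up all probes, so none is left for the present pair, which stays.
\<close>

lemma not_cops_win_blowup:
  assumes "k \<le> 2 * r\<^sup>2" and "0 < k"
  shows "\<not> blowup.cops_win r k"
proof -
  let ?N = "(2 * r + 1)\<^sup>2"
  let ?W = "\<lambda>a b. a \<noteq> b \<and> a < ?N \<and> b < ?N \<and> offset r a b = 0"
  have "0 < r" using assms by (cases r) auto
  then have start: "?W 0 (2 * r + 1)"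
    by (auto simp: offset_eq_0_iff power2_eq_square)
  show ?thesis
  proof (rule blowup.robber_evades[where W = ?W, OF start])
    fix a b us
    assume W: "?W a b" and len: "length us = k" and us: "set us \<subseteq> verts (blowup r)"
    define P where "P = set us"
    have P: "finite P" "card P \<le> 2 * r\<^sup>2" "P \<subseteq> {..<?N}"
      using card_length[of us] len us assms(1) by (auto simp: P_def)
    define Out where "Out d = {v. v < ?N \<and> offset r a v = int d}" for d :: nat
    have fin: "finite (Out d)" for d by (simp add: Out_def)
    have twins: "blowup.probe r us x = blowup.probe r us y"
      if "x < ?N" "y < ?N" "offset r x y = 0" "x \<notin> P" "y \<notin> P" for x y
      unfolding blowup.probe_def
      using that P(3) by (auto simp: P_def intro!: dist_blowup_twin)
    show "\<exists>a' b'. ?W a' b' \<and> (a' = a \<or> a \<rightarrow>\<^bsub>blowup r\<^esub> a') \<and> (b' = b \<or> b \<rightarrow>\<^bsub>blowup r\<^esub> b') \<and>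
      blowup.probe r us a' = blowup.probe r us b'"
    proof (cases "\<exists>d \<in> {1..r}. \<exists>a' \<in> Out d - P. \<exists>b' \<in> Out d - P. a' \<noteq> b'")
      case True
      then obtain d a' b' where d: "d \<in> {1..r}" and a': "a' \<in> Out d - P" and b': "b' \<in> Out d - P"
        and ne: "a' \<noteq> b'" by blast
      have "offset r a' b' = 0"
        using offset_eq_iff[of d r a] a' b' d by (simp add: Out_def offset_eq_0_iff)
      moreover have "offset r b b' = int d"
        using offset_cong_left[of r a b b'] b' W by (simp add: Out_def)
      ultimately show ?thesis
        using a' b' ne d W twins[of a' b'] by (intro exI[of _ a'] exI[of _ b'])
          (auto simp: Out_def dominates_blowup)
    next
      case False
      have "2 * r \<le> card (Out d \<inter> P)" if "d \<in> {1..r}" for d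
      proof -
        have "card (Out d - P) \<le> Suc 0"
          using False that fin by (subst card_le_Suc0_iff_eq) auto
        moreover have "card (Out d) = card (Out d \<inter> P) + card (Out d - P)"
          using card_Int_Diff[OF fin] by blast
        moreover have "card (Out d) = 2 * r + 1"
          using that card_group[of d r a] by (simp add: Out_def)
        ultimately show ?thesis by simp
      qed
      then have "(\<Sum>d = 1..r. 2 * r) \<le> (\<Sum>d = 1..r. card (Out d \<inter> P))"
        by (intro sum_mono) auto
      also have "\<dots> = card (\<Union>d \<in> {1..r}. Out d \<inter> P)"
        using fin by (subst card_UN_disjoint) (auto simp: Out_def)
      finally have "card P \<le> card (\<Union>d \<in> {1..r}. Out d \<inter> P)"
        using P(2) by (simp add: power2_eq_square)
      then have "(\<Union>d \<in> {1..r}. Out d \<inter> P) = P"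
        using P(1) by (intro card_seteq) auto
      then have "\<exists>d \<in> {1..r}. v \<in> Out d" if "v \<in> P" for v using that by blast
      then have "offset r a v \<noteq> 0" if "v \<in> P" for v using that by (force simp: Out_def)
      then have "a \<notin> P" "b \<notin> P" using W offset_self[of r a] by blast+
      then show ?thesis using W twins[of a b] by blast
    qed
  qed auto
qed

section \<open>A winning strategy\<close>

text \<open>
  The vertices below \<open>2 * r + 1\<close> represent all the groups; the zeros fill up the list to
  the length \<open>2 * r\<^sup>2 + 1\<close>.
\<close>

definition group_probe :: "nat \<Rightarrow> nat list" where
  "group_probe r = [0..<2 * r + 1] @ replicate (2 * r\<^sup>2 - 2 * r) 0"

text \<open>
  The probes for round \<open>t\<close> once the robber is known to have started in group \<open>g\<close>. All vertices
  but one are probed in each out-group, and one vertex of the group itself, a different one in each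
  of \<open>2 * r + 1\<close> successive rounds. In the last probe, \<open>g\<close> and \<open>t\<close> are reduced so that all
  probes are vertices for all \<open>g\<close> and \<open>t\<close>, as a strategy has to answer also to impossible histories.
\<close>

definition trap_probe :: "nat \<Rightarrow> nat \<Rightarrow> nat \<Rightarrow> nat list" where
  "trap_probe r g t =
    map (\<lambda>(d, c). (g + d) mod (2 * r + 1) + (2 * r + 1) * c)
      (List.product [1..<Suc r] [0..<2 * r]) @
    [g mod (2 * r + 1) + (2 * r + 1) * (t mod (2 * r + 1))]"

text \<open>
  In the first answer, an entry 0 or 3 occurs exactly at the index that is the group of the robber.
\<close>

definition cop_plan :: "nat \<Rightarrow> ereal list list \<Rightarrow> nat list" where
  "cop_plan r h =
    (if h = [] then group_probe r
     else trap_probe r (SOME g. g < 2 * r + 1 \<and> hd h ! g \<in> {0, 3}) (length h))"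

lemma cop_strategy_cop_plan: "blowup.cop_strategy r (2 * r\<^sup>2 + 1) (cop_plan r)"
proof -
  have "set (group_probe r) \<subseteq> {..<(2 * r + 1)\<^sup>2}"
    using vertex_lt[of _ "2 * r + 1" 0] by (auto simp: group_probe_def)
  moreover have "length (group_probe r) = 2 * r\<^sup>2 + 1"
    by (cases r) (auto simp: group_probe_def power2_eq_square)
  moreover have "set (trap_probe r g t) \<subseteq> {..<(2 * r + 1)\<^sup>2}" for g t
    by (auto simp: trap_probe_def intro!: vertex_lt simp del: add_2_eq_Suc' One_nat_def)
  moreover have "length (trap_probe r g t) = 2 * r\<^sup>2 + 1" for g t
    by (simp add: trap_probe_def power2_eq_square)
  ultimately show ?thesis
    by (simp add: blowup.cop_strategy_def cop_plan_def)
qed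

lemma robber_move_blowup:
  assumes "blowup.robber_play r x"
  shows "x (Suc t) = x t \<or>
    (\<exists>d \<in> {1..r}. x (Suc t) mod (2 * r + 1) = (x t + d) mod (2 * r + 1))"
proof (cases "x (Suc t) = x t")
  case False
  then have o: "offset r (x t) (x (Suc t)) \<in> {1..int r}"
    using assms by (auto simp: blowup.robber_play_def dominates_blowup)
  define d where "d = nat (offset r (x t) (x (Suc t)))"
  have "d \<in> {1..r}" "offset r (x t) (x (Suc t)) = int d" using o by (auto simp: d_def)
  then show ?thesis using offset_eq_iff[of d r "x t" "x (Suc t)"] by auto
qed simp

lemma cop_plan_answers:
  assumes "x 0 < (2 * r + 1)\<^sup>2"
  shows "cop_plan r (blowup.answers r (cop_plan r) x (Suc t)) =
    trap_probe r (x 0 mod (2 * r + 1)) (Suc t)"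
proof -
  let ?m = "2 * r + 1" and ?h = "blowup.answers r (cop_plan r) x (Suc t)"
  have "hd ?h = blowup.probe r (group_probe r) (x 0)"
    unfolding blowup.hd_answers_Suc by (simp add: cop_plan_def)
  then have nth: "hd ?h ! i = blowup.digraph_dist r i (x 0)" if "i < ?m" for i
    using that by (simp add: blowup.probe_def group_probe_def nth_append del: upt_Suc)
  have "i < ?m \<and> hd ?h ! i \<in> {0, 3} \<longleftrightarrow> i = x 0 mod ?m" for i
  proof (cases "i < ?m")
    case True
    then have "i < ?m\<^sup>2" using vertex_lt[of i ?m 0] by simp
    then show ?thesis
      using dist_blowup_same_group_iff[of i r "x 0"] assms True by (simp only: nth) auto
  qed auto
  then have "(SOME i. i < ?m \<and> hd ?h ! i \<in> {0, 3}) = x 0 mod ?m" by (simp only:) simp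
  moreover have "?h \<noteq> []" by simp
  ultimately show ?thesis
    unfolding cop_plan_def by (simp only: if_False blowup.length_answers)
qed

lemma trap_probe_out_group:
  assumes "d \<in> {1..r}" "c < 2 * r"
  shows "(g + d) mod (2 * r + 1) + (2 * r + 1) * c \<in> set (trap_probe r g t)"
proof -
  have "(d, c) \<in> set (List.product [1..<Suc r] [0..<2 * r])" using assms by auto
  then show ?thesis unfolding trap_probe_def by force
qed

lemma trap_probe_own_group:
  assumes "t < 2 * r + 1"
  shows "g mod (2 * r + 1) + (2 * r + 1) * t \<in> set (trap_probe r g t)"
  using assms by (simp add: trap_probe_def)

text \<open>
  If the robber is in his first group for \<open>2 * r + 1\<close> rounds, then he stands still and is probed in
  the round that belongs to his vertex. Otherwise he is identified in the round \<open>s\<close> in which he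
  first appears outside: as long as he is in the first group, so is every other play with the same
  answers, and therefore all these plays arrive in an out-group in round \<open>s\<close>. There the cops know the
  group and have probed all of its vertices but one.
\<close>

lemma cops_win_blowup: "blowup.cops_win r (2 * r\<^sup>2 + 1)"
proof -
  let ?m = "2 * r + 1" and ?\<sigma> = "cop_plan r"
  let ?ans = "blowup.answers r ?\<sigma>" and ?dist = "blowup.digraph_dist r"
  have lt: "z t < ?m\<^sup>2" if "blowup.robber_play r z" for z t
    using blowup.robber_play_in_verts[OF that] by simp
  have "\<exists>t v. blowup.possible_vertices r ?\<sigma> x t = {v}" if x: "blowup.robber_play r x" for x
  proof -
    define g where "g = x 0 mod ?m"
    have plan: "?\<sigma> (?ans x (Suc t)) = trap_probe r g (Suc t)" for t
      unfolding g_def by (rule cop_plan_answers) (rule lt[OF x])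
    have small: "i < ?m \<Longrightarrow> i < ?m\<^sup>2" for i
      using vertex_lt[of i ?m 0] by simp
    have uniqueI: ?thesis
      if "\<And>y. \<lbrakk>blowup.robber_play r y; ?ans y (Suc s) = ?ans x (Suc s)\<rbrakk> \<Longrightarrow> y s = x s" for s
    proof -
      have "blowup.possible_vertices r ?\<sigma> x s = {x s}"
        unfolding blowup.possible_vertices_def using that x by blast
      then show ?thesis by blast
    qed
    (* An answer 0 identifies a vertex, whichever of the two plays stands on the probe. *)
    have seen: "y s = x s"
      if "blowup.robber_play r y" "?ans y (Suc s) = ?ans x (Suc s)"
        "x s \<in> set (?\<sigma> (?ans x s)) \<or> y s \<in> set (?\<sigma> (?ans x s))" for y s
      using that(3) blowup.answers_eqD[OF that(2) order_refl]
        dist_blowup_eq_0_iff[OF lt[OF x, of s] lt[OF x, of s]]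
        dist_blowup_eq_0_iff[OF lt[OF x, of s] lt[OF that(1), of s]]
        dist_blowup_eq_0_iff[OF lt[OF that(1), of s] lt[OF x, of s]]
        dist_blowup_eq_0_iff[OF lt[OF that(1), of s] lt[OF that(1), of s]]
      by metis
    have move: "z (Suc t) mod ?m = g \<or> (\<exists>d \<in> {1..r}. z (Suc t) mod ?m = (g + d) mod ?m)"
      if "blowup.robber_play r z" "z t mod ?m = g" for z t
      using robber_move_blowup[OF that(1), of t] that(2) by (metis mod_add_left_eq)
    have same_group: "y t mod ?m = x t mod ?m"
      if y: "blowup.robber_play r y" and eq: "?ans y (Suc s) = ?ans x (Suc s)"
        and stay: "\<And>t. t < s \<Longrightarrow> x t mod ?m = g" and "t \<le> s" for y s t
      using \<open>t \<le> s\<close>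
    proof (induct t)
      case 0
      have "g < ?m" by (simp add: g_def)
      then have "g \<in> set (?\<sigma> (?ans x 0))"
        by (auto simp: cop_plan_def group_probe_def simp del: upt_Suc)
      then have "?dist g (y 0) = ?dist g (x 0)"
        by (rule blowup.answers_eqD[OF eq 0])
      with dist_blowup_same_group_iff[OF small[OF \<open>g < ?m\<close>] lt[OF y, of 0]]
        dist_blowup_same_group_iff[OF small[OF \<open>g < ?m\<close>] lt[OF x, of 0]]
      show ?case by (simp add: g_def)
    next
      case (Suc t)
      then have xt: "x t mod ?m = g" and yt: "y t mod ?m = g" using stay by auto
      have probed: "y (Suc t) mod ?m = x (Suc t) mod ?m"
        if d: "d \<in> {1..r}" and
          z: "(g + d) mod ?m = x (Suc t) mod ?m \<or> (g + d) mod ?m = y (Suc t) mod ?m" for d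
      proof -
        let ?u = "(g + d) mod ?m"
        have u: "?u < ?m\<^sup>2" "?u mod ?m = ?u" by (intro small) simp_all
        have "?u \<in> set (?\<sigma> (?ans x (Suc t)))"
          unfolding plan using trap_probe_out_group[OF d, of 0 g "Suc t"] d by auto
        then have "?dist ?u (y (Suc t)) = ?dist ?u (x (Suc t))"
          by (rule blowup.answers_eqD[OF eq Suc.prems])
        with dist_blowup_same_group_iff[OF u(1) lt[OF y, of "Suc t"]]
          dist_blowup_same_group_iff[OF u(1) lt[OF x, of "Suc t"]] u(2) z
        show ?thesis by metis
      qed
      show ?case
        using move[OF x xt] move[OF y yt] probed by metis
    qed
    show ?thesis
    proof (cases "\<forall>t \<le> 2 * r. x t mod ?m = g")
      case True
      have const: "t \<le> 2 * r \<Longrightarrow> x t = x 0" for t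
      proof (induct t)
        case (Suc t)
        then have "offset r (x t) (x (Suc t)) = 0" using True by (simp add: offset_eq_0_iff)
        then show ?case using x Suc
          by (auto simp: blowup.robber_play_def dominates_blowup dest!: spec[of _ t])
      qed simp
      (* The position of the robber inside his group is also the round in which it is probed. *)
      define c where "c = x 0 div ?m"
      have "c < ?m" unfolding c_def
        using lt[OF x, of 0] by (intro less_mult_imp_div_less) (simp add: power2_eq_square)
      then have xc: "x c = g + ?m * c"
        using const[of c] mod_mult_div_eq[of "x 0" ?m] by (simp add: g_def c_def)
      have "x c \<in> set (?\<sigma> (?ans x c))"
      proof (cases c)
        case 0
        then have "x c = g" using xc by simp
        moreover have "g < ?m" by (simp add: g_def)
        ultimately have "x c < ?m" by simp
        then show ?thesis using 0
          by (auto simp: cop_plan_def group_probe_def simp del: upt_Suc)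
      next
        case (Suc c')
        then show ?thesis
          using trap_probe_own_group[OF \<open>c < ?m\<close>, of g] plan[of c'] xc by (simp add: g_def)
      qed
      then show ?thesis using seen by (intro uniqueI[of c]) blast
    next
      case False
      define s where "s = (LEAST t. x t mod ?m \<noteq> g)"
      from False obtain t where "x t mod ?m \<noteq> g" by blast
      then have s: "x s mod ?m \<noteq> g" unfolding s_def by (rule LeastI)
      have stay: "x t mod ?m = g" if "t < s" for t
        using not_less_Least[OF that[unfolded s_def]] by blast
      have "s \<noteq> 0"
      proof
        assume "s = 0"
        with s show False by (simp add: g_def)
      qed
      then obtain s' where s': "s = Suc s'" by (cases s) auto
      obtain d where d: "d \<in> {1..r}" "x s mod ?m = (g + d) mod ?m"
        using move[OF x stay[of s']] s s' by auto
      show ?thesis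
      proof (rule uniqueI[of s])
        fix y assume y: "blowup.robber_play r y" and eq: "?ans y (Suc s) = ?ans x (Suc s)"
        have ys: "y s mod ?m = (g + d) mod ?m"
          using same_group[OF y eq stay order_refl] d(2) by simp
        have form: "z = (g + d) mod ?m + ?m * (z div ?m)" if "z mod ?m = (g + d) mod ?m" for z
          using mod_mult_div_eq[of z ?m] that by simp
        have probed: "z \<in> set (?\<sigma> (?ans x s))"
          if "z mod ?m = (g + d) mod ?m" "z div ?m < 2 * r" for z
          unfolding s' plan by (subst form[OF that(1)]) (rule trap_probe_out_group[OF d(1) that(2)])
        have div: "z div ?m \<le> 2 * r" if "z < ?m\<^sup>2" for z
          using less_mult_imp_div_less[of z ?m ?m] that by (simp add: power2_eq_square)
        show "y s = x s"
        proof (cases "x s div ?m < 2 * r \<or> y s div ?m < 2 * r")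
          case True
          then show ?thesis using seen[OF y eq] probed d(2) ys by blast
        next
          case False
          (* Both plays are at the only vertex of the out-group that is not probed. *)
          then have "x s div ?m = y s div ?m"
            using div[OF lt[OF x, of s]] div[OF lt[OF y, of s]] by linarith
          then show ?thesis using form[OF d(2)] form[OF ys] by metis
        qed
      qed
    qed
  qed
  then show ?thesis
    unfolding blowup.cops_win_def using cop_strategy_cop_plan by blast
qed

lemma localization_number_blowup: "blowup.localization_number r = 2 * r\<^sup>2 + 1"
  unfolding blowup.localization_number_def
proof (rule Least_equality)
  show "0 < 2 * r\<^sup>2 + 1 \<and> blowup.cops_win r (2 * r\<^sup>2 + 1)"
    using cops_win_blowup by simp
  show "2 * r\<^sup>2 + 1 \<le> k" if "0 < k \<and> blowup.cops_win r k" for k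
    by (rule ccontr) (use that not_cops_win_blowup[of k r] in auto)
qed

section \<open>The localization number as a function of the order\<close>

theorem theorem5:
  shows "\<exists>\<epsilon> :: nat \<Rightarrow> real. \<epsilon> \<in> o(\<lambda>_. 1) \<and>
    (\<forall>(n :: nat) (m :: int). odd m \<and> int n = m\<^sup>2 \<longrightarrow>
      (\<exists>G :: (nat, nat \<times> nat) pre_digraph.
        oriented_digraph G \<and> card (verts G) = n \<and>
        real (oriented_digraph.localization_number G) = real n / 2 - sqrt (real n) + 3 / 2 \<and>
        real n / 2 - sqrt (real n) + 3 / 2 = (1 - \<epsilon> n) * (real n / 2)))"
proof (intro exI conjI allI impI)
  (* Solving the last equation for \<open>\<epsilon> n\<close> leaves no choice. *)
  let ?\<epsilon> = "\<lambda>n::nat. 2 / sqrt (real n) - 3 / real n"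
  have "(\<lambda>n::nat. 2 / sqrt (real n)) \<longlonglongrightarrow> 0"
    by (intro tendsto_divide_0[OF tendsto_const] filterlim_at_top_imp_at_infinity
        filterlim_compose[OF sqrt_at_top] filterlim_real_sequentially)
  moreover have "(\<lambda>n::nat. 3 / real n) \<longlonglongrightarrow> 0" by (rule lim_const_over_n)
  ultimately have "?\<epsilon> \<longlonglongrightarrow> 0 - 0" by (rule tendsto_diff)
  then show "?\<epsilon> \<in> o(\<lambda>_. 1)" by (intro smalloI_tendsto) simp_all
  fix n :: nat and m :: int
  assume nm: "odd m \<and> int n = m\<^sup>2"
  define r where "r = nat (\<bar>m\<bar> div 2)"
  have "odd \<bar>m\<bar>" using nm by simp
  then have "\<bar>m\<bar> = 2 * int r + 1"
    unfolding r_def using odd_two_times_div_two_succ[of "\<bar>m\<bar>"] by simp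
  then have "int n = (2 * int r + 1)\<^sup>2" using nm by (metis power2_abs)
  then have n: "n = (2 * r + 1)\<^sup>2"
    unfolding of_nat_eq_iff[where 'a = int, symmetric] by simp
  have root: "sqrt (real n) = 2 * real r + 1" by (simp add: n)
  show "oriented_digraph (blowup r)" by (rule oriented_digraph_blowup)
  show "card (verts (blowup r)) = n" by (simp add: n)
  show "real (blowup.localization_number r) = real n / 2 - sqrt (real n) + 3 / 2"
    unfolding localization_number_blowup root by (simp add: n power2_eq_square field_simps)
  have "real n = sqrt (real n) * sqrt (real n)" and "sqrt (real n) > 0"
    using real_sqrt_mult_self[of "real n"] root by simp_all
  then show "real n / 2 - sqrt (real n) + 3 / 2 = (1 - ?\<epsilon> n) * (real n / 2)"
    by (simp add: field_simps)
qed

end
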